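(* Let $N\ge 3$ and $0<\varepsilon<\tfrac12$, and let $N$ agents evolve under the bilateral erratic-extremist dynamics from initial positions whose fractional parts are pairwise distinct, with ordered positions $x_1(t)<x_2(t)<\cdots<x_N(t)$ at time $t$. If at some time $T$ one has $x_{N-1}(T)-x_2(T)\le 1$, then $x_{N-1}(T+1)-x_2(T+1)\le 1$. Hence $x_{N-1}(t)-x_2(t)\le 1$ for all $t>T$.
   Context: Bilateral erratic-extremist dynamics: $N$ identical agents sit on the real line and move at discrete times $t=0,1,2,\ldots$. Between time $t$ and $t+1$ only the two extremal agents move, simultaneously and independently of each other and of the past: the leftmost agent (at $x_1(t)$) jumps by $+1$ with probability $1-\varepsilon$ and by $-1$ with probability $\varepsilon$; the rightmost agent (at $x_N(t)$) jumps by $-1$ with probability $1-\varepsilon$ and by $+1$ with probability $\varepsilon$. All other agents stay put. After each step the agents are relabelled in increasing order of position, so that $x_1(t)<x_2(t)<\cdots<x_N(t)$ always denote the ordered positions at time $t$ (positions remain distinct since fractional parts are distinct and invariant under unit jumps). *)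

theory Defs
  imports "HOL-Probability.Probability"
begin

datatype side = Leftmost | Rightmost

text \<open>The randomness of the dynamics: \<open>E t s \<omega>\<close> says that between time \<open>t\<close> and \<open>t + 1\<close> the
  extremal agent on side \<open>s\<close> jumps erratically, that is, outwards (away from the other agents).
  Joint independence over all pairs \<open>(t, s)\<close> covers both the independence of the two
  simultaneous jumps and the independence of the past, since the initial positions below are
  deterministic.\<close>

locale erratic_choices = prob_space M
  for M :: "'a measure" and \<epsilon> :: real and E :: "nat \<Rightarrow> side \<Rightarrow> 'a \<Rightarrow> bool" +
  assumes indep: "indep_vars (\<lambda>_. count_space UNIV) (\<lambda>(t, s). E t s) UNIV"
    and law: "\<And>t s. distr M (count_space UNIV) (E t s) = measure_pmf (bernoulli_pmf \<epsilon>)"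

fun jump :: "side \<Rightarrow> bool \<Rightarrow> real" where
  "jump Leftmost erratic = (if erratic then -1 else 1)"
| "jump Rightmost erratic = (if erratic then 1 else -1)"

text \<open>A configuration is the increasing list of the agents' positions; sorting is the
  relabelling after each step. With at least two agents the two updated entries are different.\<close>

definition step :: "(side \<Rightarrow> bool) \<Rightarrow> real list \<Rightarrow> real list" where
  "step e xs = (let n = length xs in
     sort (xs[0 := xs ! 0 + jump Leftmost (e Leftmost),
              n - 1 := xs ! (n - 1) + jump Rightmost (e Rightmost)]))"

primrec config :: "real list \<Rightarrow> (nat \<Rightarrow> side \<Rightarrow> 'a \<Rightarrow> bool) \<Rightarrow> nat \<Rightarrow> 'a \<Rightarrow> real list" where
  "config p E 0 \<omega> = sort p"
| "config p E (Suc t) \<omega> = step (\<lambda>s. E t s \<omega>) (config p E t \<omega>)"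

text \<open>The position $x_k(t)$, with \<open>k\<close> counted from 1 while list indices start at 0.\<close>

definition position :: "real list \<Rightarrow> (nat \<Rightarrow> side \<Rightarrow> 'a \<Rightarrow> bool) \<Rightarrow> nat \<Rightarrow> nat \<Rightarrow> 'a \<Rightarrow> real" where
  "position p E k t \<omega> = config p E t \<omega> ! (k - 1)"

lemma length_config [simp]: "length (config p E t \<omega>) = length p"
  by (induction t) (simp_all add: step_def Let_def)

lemma frac_jump: "frac (x + jump s b) = frac x"
proof -
  have "frac (x - 1) = frac x" using frac_1_eq[of "x - 1"] by simp
  then show ?thesis by (cases s; cases b) (simp_all add: frac_1_eq)
qed

lemma mset_frac_step: "mset (map frac (step e xs)) = mset (map frac xs)"
proof -
  have "map frac (xs[0 := xs ! 0 + jump Leftmost (e Leftmost),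
      length xs - 1 := xs ! (length xs - 1) + jump Rightmost (e Rightmost)]) = map frac xs"
    by (simp only: map_update frac_jump) (simp flip: map_update)
  from arg_cong[OF this, of mset] show ?thesis
    by (simp only: step_def Let_def mset_map mset_sort)
qed

lemma mset_frac_config: "mset (map frac (config p E t \<omega>)) = mset (map frac p)"
proof (induction t)
  case 0
  show ?case by simp
next
  case (Suc t)
  then show ?case by (simp only: config.simps mset_frac_step)
qed

lemma config_strictly_increasing:
  assumes "distinct (map frac p)"
  shows "sorted_wrt (<) (config p E t \<omega>)"
proof -
  have "distinct (map frac (config p E t \<omega>))"
    using assms by (rule mset_eq_imp_distinct_iff[OF mset_frac_config, THEN iffD2])
  then have "distinct (config p E t \<omega>)" by (simp only: distinct_map)
  moreover have "sorted (config p E t \<omega>)"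
    by (cases t) (simp_all add: step_def Let_def del: jump.simps)
  ultimately show ?thesis by (simp only: strict_sorted_iff)
qed

end

theory Submission imports Defs begin

text \<open>The bound is pathwise. Let \<open>l\<close> and \<open>u\<close> be the extreme interior positions, \<open>u - l \<le> 1\<close>, and let
  \<open>a'\<close>, \<open>b'\<close> be where the leftmost and rightmost agents land, so that \<open>a' \<le> l + 1\<close> and
  \<open>b' \<ge> u - 1\<close>. At most one agent lies below \<open>min l (max a' b')\<close> and at most one above
  \<open>max u (min a' b')\<close>; these two numbers therefore enclose the new interior, and they differ by
  at most 1.\<close>

text \<open>If entry \<open>i\<close> were below \<open>L\<close>, so would be all
  \<open>i + 1\<close> entries up to it, which is one too many. Counting in the multiset allows the
  bound to be checked before sorting.\<close>

lemma sorted_nth_ge_if_few_below: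
  fixes xs :: "'b::linorder list"
  assumes "sorted xs" "i < length xs" "size {#x \<in># mset xs. x < L#} \<le> i"
  shows "L \<le> xs ! i"
proof (rule ccontr)
  assume "\<not> L \<le> xs ! i"
  then have "x < L" if "x \<in> set (take (Suc i) xs)" for x
    using that assms(1,2)
    by (auto simp: in_set_conv_nth less_Suc_eq_le not_le intro: le_less_trans[OF sorted_nth_mono])
  then have "filter (\<lambda>x. x < L) (take (Suc i) xs) = take (Suc i) xs"
    by (simp add: filter_id_conv)
  then have "Suc i \<le> length (filter (\<lambda>x. x < L) (take (Suc i) xs @ drop (Suc i) xs))"
    using assms(2) by (simp del: append_take_drop_id)
  then show False
    using assms(3) by (simp flip: mset_filter)
qed

lemma sorted_nth_le_if_few_above:
  fixes xs :: "'b::linorder list"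
  assumes "sorted xs" "i < length xs" "size {#x \<in># mset xs. U < x#} < length xs - i"
  shows "xs ! i \<le> U"
proof (rule ccontr)
  assume "\<not> xs ! i \<le> U"
  then have "U < x" if "x \<in> set (drop i xs)" for x
    using that assms(1,2)
    by (auto simp: in_set_conv_nth not_le intro: less_le_trans[OF _ sorted_nth_mono])
  then have "filter (\<lambda>x. U < x) (drop i xs) = drop i xs"
    by (simp add: filter_id_conv)
  then have "length xs - i \<le> length (filter (\<lambda>x. U < x) (take i xs @ drop i xs))"
    by (simp del: append_take_drop_id)
  then show False
    using assms(3) by (simp flip: mset_filter)
qed

lemma sorted_config: "sorted (config p E t \<omega>)"
  by (cases t) (simp_all add: step_def Let_def)

text \<open>Splitting off both ends makes the two updated places disjoint and shows that the
  interior \<open>zs\<close> is untouched.\<close>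

lemma step_Cons_snoc:
  "step e (a # zs @ [b]) =
    sort ((a + jump Leftmost (e Leftmost)) # zs @ [b + jump Rightmost (e Rightmost)])"
  by (simp add: step_def Let_def list_update_append nth_append)

lemma jump_le_1: "jump s b \<le> 1" and jump_ge_minus_1: "- 1 \<le> jump s b"
  by (cases s; cases b; simp)+

lemma step_interior_width:
  assumes "sorted xs" "3 \<le> length xs" "xs ! (length xs - 2) - xs ! 1 \<le> 1"
  shows "step e xs ! (length xs - 2) - step e xs ! 1 \<le> 1"
proof -
  obtain a ys where "xs = a # ys"
    using assms(2) by (cases xs) auto
  moreover obtain zs b where "ys = zs @ [b]"
    using assms(2) calculation by (cases ys rule: rev_cases) auto
  ultimately have xs: "xs = a # zs @ [b]"
    by simp
  then have "zs \<noteq> []"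
    using assms(2) by auto
  define l u where "l = hd zs" and "u = last zs"
  have nth: "xs ! 1 = l" "xs ! (length xs - 2) = u"
    using \<open>zs \<noteq> []\<close> by (auto simp: xs l_def u_def nth_append hd_conv_nth last_conv_nth nth_Cons')
  have zs: "l \<le> z" "z \<le> u" if "z \<in> set zs" for z
  proof -
    have "sorted zs"
      using assms(1) by (simp add: xs sorted_append)
    with that \<open>zs \<noteq> []\<close> show "l \<le> z" "z \<le> u"
      by (auto simp: l_def u_def hd_conv_nth last_conv_nth in_set_conv_nth intro!: sorted_nth_mono)
  qed
  have "a \<le> l" "u \<le> b"
    using assms(1) \<open>zs \<noteq> []\<close> by (auto simp: xs l_def u_def sorted_append)
  define a' b' where "a' = a + jump Leftmost (e Leftmost)"
    and "b' = b + jump Rightmost (e Rightmost)"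
  \<comment> \<open>Inward jumps are the extreme case here; outward jumps only help.\<close>
  have "a' \<le> l + 1" "u - 1 \<le> b'"
    using \<open>a \<le> l\<close> \<open>u \<le> b\<close> jump_le_1[of Leftmost "e Leftmost"]
      jump_ge_minus_1[of Rightmost "e Rightmost"]
    by (simp_all add: a'_def b'_def)
  have step: "step e xs = sort (a' # zs @ [b'])"
    by (simp only: xs step_Cons_snoc a'_def b'_def)
  define L U where "L = min l (max a' b')" and "U = max u (min a' b')"
  have "L \<le> z" "z \<le> U" if "z \<in> set zs" for z
    using zs[OF that] by (auto simp: L_def U_def)
  then have "{#z \<in># mset zs. z < L#} = {#}" "{#z \<in># mset zs. U < z#} = {#}"
    by (simp_all add: not_less)
  \<comment> \<open>A maximum or minimum of two numbers is attained, so at most one of the two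
    jumpers can violate each bound.\<close>
  moreover have "L \<le> a' \<or> L \<le> b'" "a' \<le> U \<or> b' \<le> U"
    by (auto simp: L_def U_def)
  ultimately have "size {#z \<in># mset (step e xs). z < L#} \<le> 1"
    and "size {#z \<in># mset (step e xs). U < z#} \<le> 1"
    by (auto simp: step not_less simp del: filter_mset_eq_mempty_iff)
  moreover have "sorted (step e xs)" "length (step e xs) = length xs"
    by (simp_all add: step_def Let_def)
  \<comment> \<open>From index \<open>length xs - 2\<close> on there are exactly two entries, so one
    exception above \<open>U\<close> is allowed.\<close>
  ultimately have "L \<le> step e xs ! 1" "step e xs ! (length xs - 2) \<le> U"
    using assms(2) by (auto intro!: sorted_nth_ge_if_few_below sorted_nth_le_if_few_above)
  \<comment> \<open>Four cases: \<open>u - l\<close> is at most 1 by assumption,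
    \<open>u - max a' b'\<close> is at most \<open>u - b'\<close>, \<open>min a' b' - l\<close> is
    at most \<open>a' - l\<close>, and \<open>min a' b' - max a' b'\<close> is at most 0.\<close>
  moreover have "U - L \<le> 1"
    using assms(3) \<open>a' \<le> l + 1\<close> \<open>u - 1 \<le> b'\<close> unfolding nth L_def U_def by linarith
  ultimately show ?thesis
    by linarith
qed

theorem theorem2:
  fixes M :: "'a measure" and N :: nat and \<epsilon> :: real
    and p :: "real list" and E :: "nat \<Rightarrow> side \<Rightarrow> 'a \<Rightarrow> bool"
  assumes "N \<ge> 3" and "0 < \<epsilon>" and "\<epsilon> < 1 / 2"
    and "erratic_choices M \<epsilon> E"
    and "length p = N" and "distinct (map frac p)"
  shows "\<forall>\<omega>\<in>space M. \<forall>T.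
      position p E (N - 1) T \<omega> - position p E 2 T \<omega> \<le> 1 \<longrightarrow>
        position p E (N - 1) (T + 1) \<omega> - position p E 2 (T + 1) \<omega> \<le> 1 \<and>
        (\<forall>t>T. position p E (N - 1) t \<omega> - position p E 2 t \<omega> \<le> 1)"
proof (intro ballI allI impI)
  fix \<omega> T
  let ?P = "\<lambda>t. position p E (N - 1) t \<omega> - position p E 2 t \<omega> \<le> 1"
  have Suc: "?P (Suc t)" if "?P t" for t
    using step_interior_width[OF sorted_config[of p E t \<omega>], of "\<lambda>s. E t s \<omega>"] that assms(1,5)
    by (simp add: position_def numeral_2_eq_2)
  assume "?P T"
  \<comment> \<open>Including \<open>t = T\<close> makes the assumption the base case; both
    conclusions are then instances.\<close>
  have "?P t" if "T \<le> t" for t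
    using that by (induction t rule: dec_induct) (rule \<open>?P T\<close>, rule Suc)
  then show "?P (T + 1) \<and> (\<forall>t>T. ?P t)"
    by simp
qed

end
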